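(* The Bartholdi–Enriquez–Etingof–Rains complex $\Omega_3$ (the case $n=3$ of the complex $\Omega_n$), with its intrinsic path metric, is not locally CAT(0).
   Context: Definition of $\Omega_n$. Let $\mathfrak{S}_n$ be the symmetric group, with Coxeter generators $S=\{s_1,\dots,s_{n-1}\}$, $s_i=(i\;i+1)$, acting on $\mathbb{R}^n$ by $w(e_i)=e_{w(i)}$. Let $V=\{x\in\mathbb{R}^n: x_1+\cdots+x_n=0\}$ with the standard scalar product, let $o=\sum_{j=1}^n\frac{n+1-2j}{\sqrt 2}e_j\in V$, and let $C[S]=\mathrm{conv}\{w(o): w\in\mathfrak{S}_n\}$ (the permutohedron; for $n=3$ a regular hexagon). For $X\subset S$ let $W_X$ be the subgroup generated by $X$; an element $u\in\mathfrak{S}_n$ is $(\emptyset,X)$-minimal if it has minimal length (with respect to $S$) in the coset $uW_X$. The faces of $C[S]$ (including $C[S]$ itself) are the sets $F(u,X,S)=\mathrm{conv}\{uw(o): w\in W_X\}$ with $X\subset S$ and $u$ $(\emptyset,X)$-minimal. To $F(u,X,S)$ one associates the ordered partition $P(u,X)=(P_1,\dots,P_p)$ of $\{1,\dots,n\}$, where $p=n-|X|$, $S\setminus X=\{s_{i_1},\dots,s_{i_{p-1}}\}$ with $i_1<\cdots<i_{p-1}$, $i_0=0$, $i_p=n$, and $P_k=u(\{i_{k-1}+1,\dots,i_k\})$. For $w,w'\in\mathfrak{S}_n$, the faces $(F(u,X,S),w)$ and $(F(v,Y,S),w')$ of $C[S]\times\mathfrak{S}_n$ are declared equivalent if $P(u,X)$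 and $P(v,Y)$ are equal up to permuting the blocks and, for every block $P_k$ and all $i,j\in P_k$, one has $w(i)<w(j)\Leftrightarrow w'(i)<w'(j)$. In that case the translation by $v(o)-u(o)$ maps $F(u,X,S)$ isometrically onto $F(v,Y,S)$. The complex $\Omega_n$ is the quotient of $C[S]\times\mathfrak{S}_n$ by the relation identifying $(x,w)$ with $(x+v(o)-u(o),w')$ for every $x\in F(u,X,S)$, for all pairs of equivalent faces $(F(u,X,S),w)$, $(F(v,Y,S),w')$. Since the identifications are isometries of faces, the Euclidean metric of $C[S]$ induces a piecewise Euclidean structure on $\Omega_n$, and $\Omega_n$ is endowed with the associated intrinsic path metric. *)

theory Defs
  imports "HOL-Analysis.Analysis" "HOL-Algebra.Sym_Groups"
begin

text \<open>
  Euclidean space of dimension \<open>n\<close> is \<open>real^'n\<close> with \<open>'n\<close> a numeral type and \<open>n = CARD('n)\<close>.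
  Permutations act on the naturals \<open>{1..n}\<close> (the library's \<^const>\<open>sym_group\<close>), and the number \<open>i\<close>
  labels the coordinate \<open>of_nat i\<close>; on a numeral type this is a bijection from \<open>{1..n}\<close> onto the
  coordinates (with \<open>of_nat n = 0\<close>).
\<close>

definition coxeter_gen :: "nat \<Rightarrow> nat \<Rightarrow> nat" where
  "coxeter_gen i = Transposition.transpose i (i + 1)"

definition coxeter_gens :: "nat \<Rightarrow> (nat \<Rightarrow> nat) set" where
  "coxeter_gens n = coxeter_gen ` {1..<n}"

definition coxeter_length :: "nat \<Rightarrow> (nat \<Rightarrow> nat) \<Rightarrow> nat" where
  "coxeter_length n w =
     (LEAST k. \<exists>gs. length gs = k \<and> set gs \<subseteq> coxeter_gens n \<and> foldr (\<circ>) gs id = w)"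

definition parabolic :: "nat \<Rightarrow> (nat \<Rightarrow> nat) set \<Rightarrow> (nat \<Rightarrow> nat) set" where
  "parabolic n X = generate (sym_group n) X"

definition coset_minimal :: "nat \<Rightarrow> (nat \<Rightarrow> nat) \<Rightarrow> (nat \<Rightarrow> nat) set \<Rightarrow> bool" where
  "coset_minimal n u X \<longleftrightarrow> u \<in> carrier (sym_group n) \<and>
     (\<forall>v \<in> u <#\<^bsub>sym_group n\<^esub> parabolic n X. coxeter_length n u \<le> coxeter_length n v)"

definition unit_vec :: "nat \<Rightarrow> real^'n::{finite,comm_ring_1}" where
  "unit_vec i = axis (of_nat i) 1"

definition perm_act :: "(nat \<Rightarrow> nat) \<Rightarrow> real^'n::{finite,comm_ring_1} \<Rightarrow> real^'n::{finite,comm_ring_1}" where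
  "perm_act w x = (\<Sum>i = 1..CARD('n). (x $ of_nat i) *\<^sub>R unit_vec (w i))"

definition base_point :: "real^'n::{finite,comm_ring_1}" where
  "base_point =
     (\<Sum>j = 1..CARD('n). ((real CARD('n) + 1 - 2 * real j) / sqrt 2) *\<^sub>R unit_vec j)"

definition permutohedron :: "(real^'n::{finite,comm_ring_1}) set" where
  "permutohedron = convex hull {perm_act w base_point | w. w \<in> carrier (sym_group CARD('n))}"

definition perm_face :: "(nat \<Rightarrow> nat) \<Rightarrow> (nat \<Rightarrow> nat) set \<Rightarrow> (real^'n::{finite,comm_ring_1}) set" where
  "perm_face u X = convex hull {perm_act (u \<circ> w) base_point | w. w \<in> parabolic CARD('n) X}"

text \<open>The list \<open>[i\<^sub>0, i\<^sub>1, \<dots>, i\<^sub>p]\<close> with \<open>i\<^sub>0 = 0\<close> and \<open>i\<^sub>p = n\<close>.\<close>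

definition cuts :: "nat \<Rightarrow> (nat \<Rightarrow> nat) set \<Rightarrow> nat list" where
  "cuts n X = 0 # sorted_list_of_set {i \<in> {1..<n}. coxeter_gen i \<notin> X} @ [n]"

definition ordered_partition :: "nat \<Rightarrow> (nat \<Rightarrow> nat) \<Rightarrow> (nat \<Rightarrow> nat) set \<Rightarrow> nat set list" where
  "ordered_partition n u X =
     map (\<lambda>k. u ` {cuts n X ! (k - 1) + 1 .. cuts n X ! k}) [1..<n - card X + 1]"

definition face_equiv ::
  "nat \<Rightarrow> (nat \<Rightarrow> nat) \<Rightarrow> (nat \<Rightarrow> nat) set \<Rightarrow> (nat \<Rightarrow> nat) \<Rightarrow>
   (nat \<Rightarrow> nat) \<Rightarrow> (nat \<Rightarrow> nat) set \<Rightarrow> (nat \<Rightarrow> nat) \<Rightarrow> bool" where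
  "face_equiv n u X w v Y w' \<longleftrightarrow>
     mset (ordered_partition n u X) = mset (ordered_partition n v Y) \<and>
     (\<forall>P \<in> set (ordered_partition n u X). \<forall>i\<in>P. \<forall>j\<in>P. w i < w j \<longleftrightarrow> w' i < w' j)"

type_synonym 'n cell_point = "(real^'n) \<times> (nat \<Rightarrow> nat)"

definition cell_points :: "'n::{finite,comm_ring_1} cell_point set" where
  "cell_points = permutohedron \<times> carrier (sym_group CARD('n))"

definition glue :: "('n::{finite,comm_ring_1} cell_point \<times> 'n cell_point) set" where
  "glue = {((x, w), (x + perm_act v base_point - perm_act u base_point, w')) | x u X w v Y w'.
     w \<in> carrier (sym_group CARD('n)) \<and> w' \<in> carrier (sym_group CARD('n)) \<and>
     X \<subseteq> coxeter_gens CARD('n) \<and> coset_minimal CARD('n) u X \<and>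
     Y \<subseteq> coxeter_gens CARD('n) \<and> coset_minimal CARD('n) v Y \<and>
     face_equiv CARD('n) u X w v Y w' \<and> x \<in> perm_face u X}"

text \<open>
  The quotient is by the equivalence relation generated by \<open>glue\<close>, which leaves \<open>cell_points\<close>
  invariant.
\<close>

definition Omega :: "'n::{finite,comm_ring_1} cell_point set set" where
  "Omega = cell_points // (glue \<union> glue\<inverse>)\<^sup>*"

definition Omega_class :: "'n::{finite,comm_ring_1} cell_point \<Rightarrow> 'n cell_point set" where
  "Omega_class p = (glue \<union> glue\<inverse>)\<^sup>* `` {p}"

text \<open>
  The intrinsic metric of the piecewise Euclidean complex is the infimum of the lengths of
  piecewise linear paths, i.e. of strings of straight segments each of which lies in a single cell
  and has its Euclidean length in that cell (Bridson and Haefliger, Chapter I.7).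
  \<open>Omega_string A B l\<close> says that there is such a path of length \<open>l\<close> from \<open>A\<close> to \<open>B\<close>.
\<close>

inductive Omega_string ::
  "'n::{finite,comm_ring_1} cell_point set \<Rightarrow> 'n cell_point set \<Rightarrow> real \<Rightarrow> bool" where
  refl: "A \<in> Omega \<Longrightarrow> Omega_string A A 0"
| step: "Omega_string A (Omega_class (x, w)) l \<Longrightarrow>
     (x, w) \<in> cell_points \<Longrightarrow> (y, w) \<in> cell_points \<Longrightarrow>
     Omega_string A (Omega_class (y, w)) (l + dist x y)"

definition Omega_dist ::
  "'n::{finite,comm_ring_1} cell_point set \<Rightarrow> 'n cell_point set \<Rightarrow> real" where
  "Omega_dist A B = Inf {l. Omega_string A B l}"

text \<open>
  A metric space is given by its carrier \<open>M\<close> and its distance function \<open>d\<close>, as in the locale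
  \<^locale>\<open>Metric_space\<close>. The metric axioms are not a conjunct of the properties below, so that the
  negation of such a property never holds merely because an axiom fails.
\<close>

definition geodesic_path ::
  "'a set \<Rightarrow> ('a \<Rightarrow> 'a \<Rightarrow> real) \<Rightarrow> (real \<Rightarrow> 'a) \<Rightarrow> real \<Rightarrow> 'a \<Rightarrow> 'a \<Rightarrow> bool" where
  "geodesic_path M d c l x y \<longleftrightarrow> 0 \<le> l \<and> c ` {0..l} \<subseteq> M \<and> c 0 = x \<and> c l = y \<and>
     (\<forall>s\<in>{0..l}. \<forall>t\<in>{0..l}. d (c s) (c t) = \<bar>s - t\<bar>)"

definition geodesic_space :: "'a set \<Rightarrow> ('a \<Rightarrow> 'a \<Rightarrow> real) \<Rightarrow> bool" where
  "geodesic_space M d \<longleftrightarrow> (\<forall>x\<in>M. \<forall>y\<in>M. \<exists>c l. geodesic_path M d c l x y)"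

text \<open>
  The points of the side \<open>c\<close> of a geodesic triangle, each paired with its comparison point on the
  side from \<open>p'\<close> to \<open>q'\<close> of the comparison triangle.
\<close>

definition comparison_pairs ::
  "('a \<Rightarrow> 'a \<Rightarrow> real) \<Rightarrow> (real \<Rightarrow> 'a) \<Rightarrow> real \<Rightarrow> real^2 \<Rightarrow> real^2 \<Rightarrow> ('a \<times> (real^2)) set" where
  "comparison_pairs d c l p' q' =
     {(c t, z) | t z. t \<in> {0..l} \<and> z \<in> closed_segment p' q' \<and> d (c 0) (c t) = dist p' z}"

definition CAT0_space :: "'a set \<Rightarrow> ('a \<Rightarrow> 'a \<Rightarrow> real) \<Rightarrow> bool" where
  "CAT0_space M d \<longleftrightarrow> geodesic_space M d \<and>
     (\<forall>p q r c1 l1 c2 l2 c3 l3 p' q' r'.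
        geodesic_path M d c1 l1 p q \<and> geodesic_path M d c2 l2 q r \<and> geodesic_path M d c3 l3 r p \<and>
        dist p' q' = d p q \<and> dist q' r' = d q r \<and> dist r' p' = d r p \<longrightarrow>
        (let T = comparison_pairs d c1 l1 p' q' \<union> comparison_pairs d c2 l2 q' r' \<union>
                 comparison_pairs d c3 l3 r' p'
         in \<forall>(x, x')\<in>T. \<forall>(y, y')\<in>T. d x y \<le> dist x' y'))"

text \<open>Every point has an open ball that is a CAT(0) space for the induced metric.\<close>

definition locally_CAT0 :: "'a set \<Rightarrow> ('a \<Rightarrow> 'a \<Rightarrow> real) \<Rightarrow> bool" where
  "locally_CAT0 M d \<longleftrightarrow> (\<forall>x\<in>M. \<exists>r>0. CAT0_space {y \<in> M. d x y < r} d)"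

end

(*
  All vertices of the hexagons are identified in Omega_3. The link of this vertex has edges of length
  2 pi / 3, and it contains bigons: at the vertex o, the hexagons labelled by the permutations
  (1,3,2) and (2,3,1), in one-line notation, share both edges through o, because the labels agree on
  the order of 1,2 and of 2,3, but they have different interiors, because they differ on 1,3.
  Two points a, b on the two edges, close to o, are then joined by two different segments, one in
  each hexagon, and a CAT(0) space has unique geodesics.

  Lower bounds for the metric come from functions that are 1-Lipschitz on every hexagon and respect
  the gluing. The gluing translations change every coordinate by an integral multiple of sqrt 2, so
  1-periodic functions of x_j / sqrt 2 are available. A triangular wave in the second coordinate
  shows that the two segments are geodesics (e_2 spans the direction b - a modulo (1,1,1)), and the
  distance of the coordinates to the integers, which vanishes on the boundary of the hexagon, can be
  cut off to the hexagons with w(1) < w(3) and so separates the segments.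
*)
theory Submission
  imports Defs
begin

section \<open>Distance to the integers on the real line: a 1-periodic, 1-Lipschitz triangular
  wave\<close>

lemma infdist_Ints_cong:
  fixes y z :: real
  assumes "y - z \<in> \<int>"
  shows "infdist y \<int> = infdist z \<int>"
proof -
  have le: "infdist a \<int> \<le> infdist b \<int>" if ab: "a - b \<in> \<int>" for a b :: real
  proof -
    have "infdist a \<int> \<le> dist b k" if "k \<in> \<int>" for k
    proof -
      have "k + (a - b) \<in> \<int>" using that ab by (rule Ints_add)
      then have "infdist a \<int> \<le> dist a (k + (a - b))" by (rule infdist_le)
      then show ?thesis by (simp add: dist_real_def)
    qed
    then show ?thesis
      by (subst (2) infdist_notempty) (auto intro!: cINF_greatest)
  qed
  have "z - y \<in> \<int>" using Ints_minus[OF assms] by simp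
  with le[OF assms] le[of z y] show ?thesis by simp
qed

lemma infdist_Ints_eq_self:
  fixes y :: real
  assumes "0 \<le> y" "y \<le> 1 / 2"
  shows "infdist y \<int> = y"
proof (rule antisym)
  show "infdist y \<int> \<le> y" using infdist_le[of 0 "\<int>" y] assms by simp
  have "y \<le> dist y k" if "k \<in> \<int>" for k
  proof -
    from that obtain n where n: "k = of_int n" by (auto elim: Ints_cases)
    have "n \<le> 0 \<or> n \<ge> 1" by linarith
    then have "k \<le> 0 \<or> k \<ge> 1" unfolding n by auto
    then show ?thesis using assms by (auto simp: dist_real_def)
  qed
  then show "y \<le> infdist y \<int>"
    by (subst infdist_notempty) (auto intro!: cINF_greatest)
qed

lemma infdist_Ints_pos:
  fixes y :: real
  assumes "of_int n < y" "y < of_int n + 1"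
  shows "0 < infdist y \<int>"
proof -
  have "y \<notin> \<int>"
    using assms by (auto elim!: Ints_cases)
  then have "infdist y \<int> \<noteq> 0"
    using in_closed_iff_infdist_zero[of "\<int>" y] by (auto simp: closed_Ints)
  then show ?thesis using infdist_nonneg[of y "\<int>"] by linarith
qed

lemma infdist_Ints_diff_le: "\<bar>infdist y \<int> - infdist z \<int>\<bar> \<le> \<bar>y - z\<bar>" for y z :: real
  using infdist_triangle_abs[of y "\<int>" z] by (simp add: dist_real_def)

section \<open>The path metric: upper bounds from strings, lower bounds from functions\<close>

lemma Omega_string_nonneg: "Omega_string A B l \<Longrightarrow> 0 \<le> l"
  by (induction rule: Omega_string.induct) auto

lemma Omega_dist_le: "Omega_string A B l \<Longrightarrow> Omega_dist A B \<le> l"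
  unfolding Omega_dist_def
  by (rule cInf_lower) (auto intro!: bdd_belowI[of _ 0] dest: Omega_string_nonneg)

lemma Omega_class_in_Omega: "p \<in> cell_points \<Longrightarrow> Omega_class p \<in> Omega"
  by (auto simp: Omega_def Omega_class_def quotient_def)

lemma Omega_string_cell:
  assumes "(x, w) \<in> cell_points" "(y, w) \<in> cell_points"
  shows "Omega_string (Omega_class (x, w)) (Omega_class (y, w)) (dist x y)"
  using Omega_string.step[OF Omega_string.refl[OF Omega_class_in_Omega[OF assms(1)]] assms] by simp

lemma Omega_dist_cell_le:
  assumes "(x, w) \<in> cell_points" "(y, w) \<in> cell_points"
  shows "Omega_dist (Omega_class (x, w)) (Omega_class (y, w)) \<le> dist x y"
  by (rule Omega_dist_le[OF Omega_string_cell[OF assms]])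

lemma Omega_class_self: "p \<in> Omega_class p"
  by (simp add: Omega_class_def)

lemma Omega_class_eq_if_glue:
  assumes "(p, q) \<in> glue"
  shows "Omega_class p = Omega_class q"
proof -
  have "sym ((glue \<union> glue\<inverse>)\<^sup>*)"
    by (intro sym_rtrancl) (auto simp: sym_def)
  moreover have "(p, q) \<in> (glue \<union> glue\<inverse>)\<^sup>*" using assms by auto
  ultimately show ?thesis
    unfolding Omega_class_def by (blast dest: symD intro: rtrancl_trans)
qed

lemma glue_invariant_on_class:
  assumes inv: "\<And>p q. (p, q) \<in> glue \<Longrightarrow> F p = F q"
    and "q \<in> Omega_class p"
  shows "F q = F p"
proof -
  have "(p, q) \<in> (glue \<union> glue\<inverse>)\<^sup>*" using assms(2) by (simp add: Omega_class_def)
  then show ?thesis by (induction rule: rtrancl_induct) (auto dest: inv)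
qed

text \<open>Invariance under \<open>glue\<close> makes \<open>F\<close> constant on classes, so each
  segment of a string changes its value by at most the length of that segment, whichever
  representatives are chosen at the ends.\<close>

lemma Omega_string_lower_bound:
  fixes F :: "'n::{finite,comm_ring_1} cell_point \<Rightarrow> real"
  assumes inv: "\<And>p q. (p, q) \<in> glue \<Longrightarrow> F p = F q"
    and lip: "\<And>x y w. x \<in> permutohedron \<Longrightarrow> y \<in> permutohedron \<Longrightarrow> \<bar>F (x, w) - F (y, w)\<bar> \<le> dist x y"
    and "Omega_string A B l" "p \<in> A" "q \<in> B"
  shows "\<bar>F p - F q\<bar> \<le> l"
  using assms(3-5)
proof (induction arbitrary: q rule: Omega_string.induct)
  case (refl A)
  then obtain a where "A = Omega_class a"
    by (auto simp: Omega_def Omega_class_def quotient_def)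
  with refl have "F p = F a" "F q = F a"
    using glue_invariant_on_class[of F] inv by blast+
  then show ?case by simp
next
  case (step A x w l y)
  have "\<bar>F p - F (x, w)\<bar> \<le> l" using step by (blast intro: Omega_class_self)
  moreover have "F q = F (y, w)"
    using glue_invariant_on_class[of F] inv step by blast
  moreover have "\<bar>F (x, w) - F (y, w)\<bar> \<le> dist x y"
    using step by (intro lip) (auto simp: cell_points_def)
  ultimately show ?case by linarith
qed

lemma Omega_dist_lower_bound:
  fixes F :: "'n::{finite,comm_ring_1} cell_point \<Rightarrow> real"
  assumes "\<And>p q. (p, q) \<in> glue \<Longrightarrow> F p = F q"
    and "\<And>x y w. x \<in> permutohedron \<Longrightarrow> y \<in> permutohedron \<Longrightarrow> \<bar>F (x, w) - F (y, w)\<bar> \<le> dist x y"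
    and "Omega_string (Omega_class p) (Omega_class q) l"
  shows "\<bar>F p - F q\<bar> \<le> Omega_dist (Omega_class p) (Omega_class q)"
  unfolding Omega_dist_def
proof (rule cInf_greatest)
  \<comment> \<open>The assumed string only serves to exclude the infimum of the empty set, about
    which nothing could be said.\<close>
  show "{l. Omega_string (Omega_class p) (Omega_class q) l} \<noteq> {}" using assms(3) by blast
qed (auto intro!: Omega_string_lower_bound[of F, OF assms(1,2)] Omega_class_self)

text \<open>The two geodesics and a constant path form a triangle with vertices \<open>p\<close>,
  \<open>q\<close>, \<open>p\<close>. Its comparison triangle is a segment, on which
  \<open>c1 t\<close> and \<open>c2 (l - t)\<close> have the same comparison point. Since
  \<open>d\<close> is not assumed to be a metric, the conclusion bounds the distance instead of
  equating the points.\<close>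

lemma CAT0_space_unique_geodesic:
  assumes cat: "CAT0_space M d"
    and g1: "geodesic_path M d c1 l p q" and g2: "geodesic_path M d c2 l q p"
    and t: "0 \<le> t" "t \<le> l"
  shows "d (c1 t) (c2 (l - t)) \<le> 0"
proof -
  define p' q' :: "real^2" where "p' = 0" and "q' = l *\<^sub>R axis 1 1"
  define z :: "real^2" where "z = t *\<^sub>R axis 1 1"
  have l: "0 \<le> l" using t by simp
  have c: "c1 0 = p" "c1 l = q" "c2 0 = q" "c2 l = p"
    and M: "p \<in> M"
    and d1: "\<And>s t. s \<in> {0..l} \<Longrightarrow> t \<in> {0..l} \<Longrightarrow> d (c1 s) (c1 t) = \<bar>s - t\<bar>"
    and d2: "\<And>s t. s \<in> {0..l} \<Longrightarrow> t \<in> {0..l} \<Longrightarrow> d (c2 s) (c2 t) = \<bar>s - t\<bar>"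
    using g1 g2 l by (auto simp: geodesic_path_def)
  have dpp: "d p p = 0" using d1[of 0 0] c l by simp
  have g3: "geodesic_path M d (\<lambda>_. p) 0 p p"
    using M dpp by (auto simp: geodesic_path_def)
  have dists: "dist p' q' = d p q" "dist q' p' = d q p" "dist p' p' = d p p"
    using d1[of 0 l] d2[of 0 l] c l dpp
    by (auto simp: p'_def q'_def dist_norm)
  have zseg: "z \<in> closed_segment p' q'"
  proof (cases "l = 0")
    case False
    then show ?thesis using t
      by (auto simp: in_segment p'_def q'_def z_def intro!: exI[of _ "t / l"])
  qed (use t in \<open>auto simp: p'_def q'_def z_def\<close>)
  have z1: "(c1 t, z) \<in> comparison_pairs d c1 l p' q'"
    using t zseg d1[of 0 t] by (auto simp: comparison_pairs_def p'_def z_def dist_norm intro!: exI[of _ t])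
  have z2: "(c2 (l - t), z) \<in> comparison_pairs d c2 l q' p'"
    using t zseg d2[of 0 "l - t"]
    by (auto simp: comparison_pairs_def q'_def z_def dist_norm closed_segment_commute scaleR_diff_left[symmetric]
        intro!: exI[of _ "l - t"])
  have "d (c1 t) (c2 (l - t)) \<le> dist z z"
    using cat[unfolded CAT0_space_def, THEN conjunct2, rule_format,
        of c1 l p q c2 l p "\<lambda>_. p" 0 p' q' p'] g1 g2 g3 dists z1 z2
    unfolding Let_def by blast
  then show ?thesis by simp
qed

section \<open>The hexagon and its faces in coordinates\<close>

lemma atLeastAtMost_Suc_0_3: "{Suc 0..3} = {Suc 0, 2, 3}"
  by auto

lemma of_nat_3_inj: "inj_on (of_nat :: nat \<Rightarrow> 3) {1..3}"
  by (auto simp: inj_on_def atLeastAtMost_Suc_0_3)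

lemma base_point_3: "(base_point :: real^3) = sqrt 2 *\<^sub>R (axis 1 1 - axis 3 1)"
  by (auto simp: base_point_def atLeastAtMost_Suc_0_3 unit_vec_def scaleR_diff_right real_div_sqrt
      minus_divide_left[symmetric])

text \<open>The middle coefficient of \<open>base_point\<close> is 0, so only the images of 1 and 3
  matter.\<close>

lemma perm_act_base_point_3:
  "perm_act w (base_point :: real^3) =
     sqrt 2 *\<^sub>R (axis (of_nat (w 1)) 1 - axis (of_nat (w 3)) 1)"
  by (auto simp: perm_act_def base_point_3 atLeastAtMost_Suc_0_3 unit_vec_def scaleR_diff_right axis_def)

lemma coxeter_gens_3: "coxeter_gens 3 = {coxeter_gen 1, coxeter_gen 2}"
proof -
  have "{1..<3::nat} = {1, 2}" by auto
  then show ?thesis by (simp add: coxeter_gens_def)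
qed

lemma coxeter_gen_1_neq_2: "coxeter_gen 1 \<noteq> coxeter_gen 2"
proof
  assume "coxeter_gen 1 = coxeter_gen 2"
  then have "coxeter_gen 1 1 = coxeter_gen 2 1" by (rule arg_cong)
  then show False by (simp add: coxeter_gen_def)
qed

lemma coxeter_gens_permutes: "X \<subseteq> coxeter_gens n \<Longrightarrow> X \<subseteq> carrier (sym_group n)"
  by (erule subset_trans)
    (auto simp: coxeter_gens_def coxeter_gen_def sym_group_carrier intro!: permutes_swap_id)

lemma parabolic_permutes:
  assumes "X \<subseteq> coxeter_gens n" "h \<in> parabolic n X"
  shows "h permutes {1..n}"
  using group.generate_in_carrier[OF sym_group_is_group coxeter_gens_permutes[OF assms(1)]] assms(2)
  by (auto simp: parabolic_def sym_group_carrier)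

text \<open>The stabilizer of \<open>j\<close> is closed under products and inverses, so it suffices
  to look at the generators.\<close>

lemma parabolic_fixes:
  assumes X: "X \<subseteq> coxeter_gens n" and fix_X: "\<And>h. h \<in> X \<Longrightarrow> h j = j" and "h \<in> parabolic n X"
  shows "h j = j"
  using assms(3) unfolding parabolic_def
proof (induction rule: generate.induct)
  case (inv h)
  have h: "h \<in> carrier (sym_group n)" using inv coxeter_gens_permutes[OF X] by auto
  then have "inj h" by (auto simp: sym_group_carrier intro: permutes_inj)
  then have "inv' h j = j" using fix_X[OF inv] by (metis inv_f_f)
  then show ?case using sym_group_inv_equality[OF h] by simp
qed (auto simp: sym_group_one sym_group_mult fix_X)

lemma perm_face_coord:
  fixes x :: "real^'n::{finite,comm_ring_1}"
  assumes "\<And>h. h \<in> parabolic CARD('n) X \<Longrightarrow> perm_act (u \<circ> h) (base_point :: (real, 'n) vec) $ j = c"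
    and "x \<in> perm_face u X"
  shows "x $ j = c"
proof -
  have "convex {x :: (real, 'n) vec. x $ j = c}"
    using convex_hyperplane[of "axis j 1 :: (real, 'n) vec" c] by (simp add: inner_axis')
  then have "perm_face u X \<subseteq> {x :: (real, 'n) vec. x $ j = c}"
    unfolding perm_face_def by (intro hull_minimal) (auto simp: assms(1))
  with assms(2) show ?thesis by auto
qed

text \<open>
  On an edge of the hexagon the coordinate belonging to the singleton block is constantly
  \<open>\<plusminus> sqrt 2\<close>.
\<close>

lemma perm_face_integral_coord:
  fixes x :: "real^3"
  assumes u: "u permutes {1..3}"
    and X: "X \<subseteq> coxeter_gens 3" "X \<noteq> coxeter_gens 3"
    and x: "x \<in> perm_face u X"
  shows "\<exists>j. x $ j / sqrt 2 \<in> \<int>"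
proof -
  have X': "coxeter_gen 1 \<notin> X \<or> coxeter_gen 2 \<notin> X" using X by (auto simp: coxeter_gens_3)
  \<comment> \<open>The two unit vectors of a vertex point along different coordinates, so their
    entries \<open>sqrt 2\<close> and \<open>- sqrt 2\<close> do not cancel.\<close>
  have uh: "(of_nat (u (h 1)) :: 3) \<noteq> of_nat (u (h 3))" if "h \<in> parabolic 3 X" for h
  proof -
    have uh: "(u \<circ> h) permutes {1..3}"
      using parabolic_permutes[OF X(1) that] u by (rule permutes_compose)
    then have "(u \<circ> h) 1 \<in> {1..3}" "(u \<circ> h) 3 \<in> {1..3}" by (simp_all only: permutes_in_image) auto
    moreover have "(u \<circ> h) 1 \<noteq> (u \<circ> h) 3" using permutes_inj[OF uh] by (simp only: inj_eq)
    ultimately show ?thesis using inj_onD[OF of_nat_3_inj, of "(u \<circ> h) 1" "(u \<circ> h) 3"] by auto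
  qed
  from X' show ?thesis
  proof
    assume 1: "coxeter_gen 1 \<notin> X"
    \<comment> \<open>The only generator that can remain in \<open>X\<close> is
      \<open>coxeter_gen 2\<close>, which fixes 1. The other case is symmetric, with 3
      fixed.\<close>
    have h: "h 1 = 1" if "h \<in> parabolic 3 X" for h
      by (rule parabolic_fixes[OF X(1) _ that])
        (use X(1) 1 in \<open>auto simp: coxeter_gens_3 coxeter_gen_def\<close>)
    have "perm_act (u \<circ> h) (base_point :: real^3) $ of_nat (u 1) = sqrt 2" if "h \<in> parabolic 3 X" for h
      using uh[OF that] h[OF that] by (simp add: perm_act_base_point_3 axis_def)
    then have "x $ of_nat (u 1) = sqrt 2"
      by (intro perm_face_coord[OF _ x]) simp
    then show ?thesis by (intro exI[of _ "of_nat (u 1)"]) simp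
  next
    assume 2: "coxeter_gen 2 \<notin> X"
    have h: "h 3 = 3" if "h \<in> parabolic 3 X" for h
      by (rule parabolic_fixes[OF X(1) _ that])
        (use X(1) 2 in \<open>auto simp: coxeter_gens_3 coxeter_gen_def\<close>)
    have "perm_act (u \<circ> h) (base_point :: real^3) $ of_nat (u 3) = - sqrt 2" if "h \<in> parabolic 3 X" for h
      using uh[OF that] h[OF that] by (simp add: perm_act_base_point_3 axis_def)
    then have "x $ of_nat (u 3) = - sqrt 2"
      by (intro perm_face_coord[OF _ x]) simp
    then show ?thesis by (intro exI[of _ "of_nat (u 3)"]) simp
  qed
qed

section \<open>Effect of the gluing on coordinates and labels\<close>

lemma ordered_partition_full:
  assumes "u permutes {1..3}"
  shows "ordered_partition 3 u (coxeter_gens 3) = [{1..3}]"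
proof -
  have "cuts 3 (coxeter_gens 3) = [0, 3]"
    by (simp add: cuts_def coxeter_gens_def)
  moreover have "card (coxeter_gens 3) = 2"
    using coxeter_gen_1_neq_2 by (simp add: coxeter_gens_3)
  ultimately show ?thesis
    using permutes_image[OF assms] by (simp add: ordered_partition_def)
qed

text \<open>The translation is a difference of two vertices, and the coordinates of vertices are
  integral multiples of \<open>sqrt 2\<close>.\<close>

lemma glue_coord_diff:
  assumes "((x, w), (y, w')) \<in> (glue :: (3 cell_point \<times> _) set)"
  shows "x $ j / sqrt 2 - y $ j / sqrt 2 \<in> \<int>"
proof -
  obtain u v where y: "y = x + perm_act v base_point - perm_act u base_point"
    using assms by (auto simp: glue_def)
  show ?thesis unfolding y
    by (simp add: perm_act_base_point_3 add_divide_distrib diff_divide_distrib axis_def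
        Ints_diff Ints_add)
qed

text \<open>Such a point lies on no proper face, so it can only be glued along the whole hexagon,
  whose partition has a single block.\<close>

lemma glue_order:
  assumes "((x, w), (y, w')) \<in> (glue :: (3 cell_point \<times> _) set)"
    and "\<And>j. x $ j / sqrt 2 \<notin> \<int>" and "i \<in> {1..3}" "j \<in> {1..3}"
  shows "w i < w j \<longleftrightarrow> w' i < w' j"
proof -
  obtain u X v Y where *: "X \<subseteq> coxeter_gens 3" "coset_minimal 3 u X" "face_equiv 3 u X w v Y w'"
    "x \<in> perm_face u X"
    using assms(1) by (auto simp: glue_def)
  have u: "u permutes {1..3}" using *(2) by (simp add: coset_minimal_def sym_group_carrier)
  have "X = coxeter_gens 3" using perm_face_integral_coord[OF u *(1) _ *(4)] assms(2) by blast
  then show ?thesis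
    using *(3) assms(3,4) by (simp add: face_equiv_def ordered_partition_full[OF u])
qed

section \<open>Euclidean geometry in the plane of the hexagon\<close>

lemma permutohedron_3_sum:
  assumes "x \<in> (permutohedron :: (real^3) set)"
  shows "x $ 1 + x $ 2 + x $ 3 = 0"
proof -
  have "convex {x :: real^3. x $ 1 + x $ 2 + x $ 3 = 0}"
    using convex_hyperplane[of "1 :: real^3" 0] by (simp add: inner_vec_def sum_3)
  moreover have "perm_act w (base_point :: real^3) \<in> {x. x $ 1 + x $ 2 + x $ 3 = 0}" for w
    using exhaust_3[of "of_nat (w 1)"] exhaust_3[of "of_nat (w 3)"]
    by (auto simp: perm_act_base_point_3 axis_def)
  ultimately have "permutohedron \<subseteq> {x :: real^3. x $ 1 + x $ 2 + x $ 3 = 0}"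
    unfolding permutohedron_def by (intro hull_minimal) auto
  with assms show ?thesis by auto
qed

lemma norm_real_3: "norm (x :: real^3) = sqrt ((x $ 1)\<^sup>2 + (x $ 2)\<^sup>2 + (x $ 3)\<^sup>2)"
  by (simp add: norm_vec_def L2_set_def sum_3)

text \<open>The factor \<open>sqrt 3\<close> is sharp: equality holds for differences parallel to
  (-1, 2, -1), the direction in which the geodesics of the bigon run.\<close>

lemma permutohedron_3_coord_le_dist:
  assumes "x \<in> (permutohedron :: (real^3) set)" "y \<in> permutohedron"
  shows "sqrt 3 * \<bar>x $ 2 / sqrt 2 - y $ 2 / sqrt 2\<bar> \<le> dist x y"
proof -
  define a b where "a = x $ 1 - y $ 1" and "b = x $ 2 - y $ 2"
  have c: "x $ 3 - y $ 3 = - a - b"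
    using permutohedron_3_sum[OF assms(1)] permutohedron_3_sum[OF assms(2)] by (simp add: a_def b_def)
  have "(sqrt 3 * \<bar>b / sqrt 2\<bar>)\<^sup>2 = 3 / 2 * b\<^sup>2"
    by (simp add: power_mult_distrib power_divide)
  \<comment> \<open>The difference of the two sides is half the square of
    \<open>2 * a + b\<close>.\<close>
  also have "\<dots> \<le> a\<^sup>2 + b\<^sup>2 + (- a - b)\<^sup>2"
    using zero_le_power2[of "2 * a + b"] by (simp add: power2_eq_square algebra_simps)
  finally have "sqrt 3 * \<bar>b / sqrt 2\<bar> \<le> sqrt (a\<^sup>2 + b\<^sup>2 + (- a - b)\<^sup>2)"
    by (rule real_le_rsqrt)
  then show ?thesis
    unfolding dist_norm norm_real_3 by (simp add: c a_def b_def diff_divide_distrib)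
qed

section \<open>Identifications along the faces through the vertex \<open>base_point\<close>\<close>

lemma convex_permutohedron: "convex permutohedron"
  by (simp add: permutohedron_def)

lemma coset_minimal_id: "coset_minimal n id X"
proof -
  have "coxeter_length n id = 0"
    unfolding coxeter_length_def by (rule Least_eq_0) auto
  then show ?thesis by (simp add: coset_minimal_def sym_group_carrier permutes_id)
qed

lemma edge_mem_perm_face:
  assumes "s \<in> X" "0 \<le> e" "e \<le> 1"
  shows "(1 - e) *\<^sub>R perm_act id base_point +
    e *\<^sub>R perm_act s (base_point :: real^'n::{finite,comm_ring_1}) \<in> perm_face id X"
proof -
  have "id \<in> parabolic CARD('n) X" "s \<in> parabolic CARD('n) X"
    using assms(1) generate.one[of "sym_group CARD('n)" X]
    by (auto simp: parabolic_def sym_group_one intro: generate.incl)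
  then show ?thesis unfolding perm_face_def
    by (intro convexD_alt convex_convex_hull hull_inc) (use assms in auto)
qed

text \<open>Both faces are taken with the minimal element \<open>id\<close>, so the gluing
  translation is 0 and only the labels have to be compared.\<close>

lemma Omega_class_eq_on_face:
  fixes x :: "real^'n::{finite,comm_ring_1}"
  assumes "w permutes {1..CARD('n)}" "w' permutes {1..CARD('n)}" "X \<subseteq> coxeter_gens CARD('n)"
    and "x \<in> perm_face id X"
    and "\<And>P i j. P \<in> set (ordered_partition CARD('n) id X) \<Longrightarrow>
      i \<in> P \<Longrightarrow> j \<in> P \<Longrightarrow> w i < w j \<longleftrightarrow> w' i < w' j"
  shows "Omega_class (x, w) = Omega_class (x, w')"
proof (rule Omega_class_eq_if_glue)
  have "face_equiv CARD('n) id X w id X w'" using assms(5) by (auto simp: face_equiv_def)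
  then have "((x, w), (x + perm_act id base_point - perm_act id base_point, w')) \<in> glue"
    unfolding glue_def using assms(1-4)
    by (intro CollectI exI[of _ x] exI[of _ id] exI[of _ X] exI[of _ w] exI[of _ w'])
      (auto simp: coset_minimal_id sym_group_carrier)
  then show "((x, w), (x, w')) \<in> glue" by simp
qed

lemma ordered_partition_edges:
  "ordered_partition 3 id {coxeter_gen 1} = [{1, 2}, {3}]"
  "ordered_partition 3 id {coxeter_gen 2} = [{1}, {2, 3}]"
proof -
  have "{i \<in> {1..<3}. coxeter_gen i \<notin> {coxeter_gen 1}} = {2}"
    "{i \<in> {1..<3}. coxeter_gen i \<notin> {coxeter_gen 2}} = {1}"
    using coxeter_gen_1_neq_2 by (auto simp: less_Suc_eq numeral_3_eq_3 numeral_2_eq_2)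
  then have "cuts 3 {coxeter_gen 1} = [0, 2, 3]" "cuts 3 {coxeter_gen 2} = [0, 1, 3]"
    unfolding cuts_def by simp_all
  moreover have "{Suc 0..2} = {1, 2}" "{Suc (Suc 0)..3} = {2, 3}" by auto
  ultimately show "ordered_partition 3 id {coxeter_gen 1} = [{1, 2}, {3}]"
    "ordered_partition 3 id {coxeter_gen 2} = [{1}, {2, 3}]"
    by (simp_all add: ordered_partition_def upt_rec)
qed

section \<open>Two lower bounds for the metric\<close>

text \<open>The assumption \<open>eq\<close> says that the segment runs in the extremal direction of
  \<open>permutohedron_3_coord_le_dist\<close>. The triangular wave in the second coordinate then
  changes by exactly the length of the segment.\<close>

lemma Omega_dist_3_cell_eq:
  fixes x y :: "real^3"
  assumes "x \<in> permutohedron" "y \<in> permutohedron" and w: "w permutes {1..3}"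
    and "\<bar>x $ 2 / sqrt 2\<bar> \<le> 1 / 4" "\<bar>y $ 2 / sqrt 2\<bar> \<le> 1 / 4"
    and eq: "dist x y = sqrt 3 * \<bar>x $ 2 / sqrt 2 - y $ 2 / sqrt 2\<bar>"
  shows "Omega_dist (Omega_class (x, w)) (Omega_class (y, w)) = dist x y"
proof (rule antisym)
  have cell: "(x, w) \<in> cell_points" "(y, w) \<in> cell_points"
    using assms by (auto simp: cell_points_def sym_group_carrier)
  then show "Omega_dist (Omega_class (x, w)) (Omega_class (y, w)) \<le> dist x y"
    by (rule Omega_dist_cell_le)
  \<comment> \<open>The shift by \<open>1/4\<close> makes the distance to the integers linear in the second coordinate
    around the vertex \<open>base_point\<close>, where that coordinate is \<open>0\<close>.\<close>
  define F :: "3 cell_point \<Rightarrow> real"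
    where "F p = sqrt 3 * infdist (fst p $ 2 / sqrt 2 + 1 / 4) \<int>" for p
  have inv: "F p = F q" if "(p, q) \<in> glue" for p q
  proof -
    have "fst p $ 2 / sqrt 2 - fst q $ 2 / sqrt 2 \<in> \<int>"
      using that glue_coord_diff[of "fst p" "snd p" "fst q" "snd q"] by simp
    then show ?thesis unfolding F_def by (subst infdist_Ints_cong) auto
  qed
  have lip: "\<bar>F (x, w) - F (y, w)\<bar> \<le> dist x y" if "x \<in> permutohedron" "y \<in> permutohedron" for x y w
  proof -
    have "\<bar>F (x, w) - F (y, w)\<bar> =
      sqrt 3 * \<bar>infdist (x $ 2 / sqrt 2 + 1 / 4) \<int> - infdist (y $ 2 / sqrt 2 + 1 / 4) \<int>\<bar>"
      by (simp add: F_def abs_mult right_diff_distrib[symmetric])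
    also have "\<dots> \<le> sqrt 3 * \<bar>x $ 2 / sqrt 2 - y $ 2 / sqrt 2\<bar>"
      using infdist_Ints_diff_le[of "x $ 2 / sqrt 2 + 1 / 4" "y $ 2 / sqrt 2 + 1 / 4"]
      by (intro mult_left_mono) auto
    also have "\<dots> \<le> dist x y" by (rule permutohedron_3_coord_le_dist[OF that])
    finally show ?thesis .
  qed
  have F_eq: "F (z, w) = sqrt 3 * (z $ 2 / sqrt 2 + 1 / 4)" if "\<bar>z $ 2 / sqrt 2\<bar> \<le> 1 / 4" for z
  proof -
    have "infdist (z $ 2 / sqrt 2 + 1 / 4) \<int> = z $ 2 / sqrt 2 + 1 / 4"
      by (rule infdist_Ints_eq_self) (use that in linarith)+
    then show ?thesis by (simp add: F_def)
  qed
  have "dist x y = \<bar>F (x, w) - F (y, w)\<bar>"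
    unfolding eq F_eq[OF assms(4)] F_eq[OF assms(5)]
    by (simp add: abs_mult right_diff_distrib[symmetric])
  also have "\<dots> \<le> Omega_dist (Omega_class (x, w)) (Omega_class (y, w))"
    by (rule Omega_dist_lower_bound[OF inv lip Omega_string_cell[OF cell]])
  finally show "dist x y \<le> Omega_dist (Omega_class (x, w)) (Omega_class (y, w))" .
qed

text \<open>A function that is positive at \<open>x\<close> in the first hexagon and vanishes on
  every hexagon whose label reverses 1 and 3 separates the two classes.\<close>

lemma Omega_dist_3_pos:
  fixes x y :: "real^3"
  assumes "w 1 < w 3" "\<not> w' 1 < w' 3" and x: "\<And>j. 0 < infdist (x $ j / sqrt 2) \<int>"
    and string: "Omega_string (Omega_class (x, w)) (Omega_class (y, w')) l"
  shows "0 < Omega_dist (Omega_class (x, w)) (Omega_class (y, w'))"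
proof -
  define h :: "real^3 \<Rightarrow> real" where "h x = Min (range (\<lambda>j. infdist (x $ j / sqrt 2) \<int>))" for x
  define F :: "3 cell_point \<Rightarrow> real" where "F p = (if snd p 1 < snd p 3 then h (fst p) else 0)" for p
  have inv: "F (x, w) = F (y, w')" if glue: "((x, w), (y, w')) \<in> glue" for x y w w'
  proof -
    have eq: "infdist (x $ j / sqrt 2) \<int> = infdist (y $ j / sqrt 2) \<int>" for j
      by (rule infdist_Ints_cong[OF glue_coord_diff[OF glue]])
    then have h_eq: "h x = h y" by (simp add: h_def)
    show ?thesis
    \<comment> \<open>If some scaled coordinate is integral, \<open>h\<close> vanishes at both
      points and the labels do not matter. Otherwise the gluing preserves the order of the labels at
      1 and 3.\<close>
    proof (cases "\<exists>j. x $ j / sqrt 2 \<in> \<int>")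
      case True
      then obtain j where "x $ j / sqrt 2 \<in> \<int>" by blast
      then have "infdist (x $ j / sqrt 2) \<int> = 0" by (rule infdist_zero)
      then have "h x \<le> 0" unfolding h_def by (metis Min_le finite finite_imageI rangeI)
      moreover have "0 \<le> h x" unfolding h_def by (subst Min_ge_iff) (auto simp: infdist_nonneg)
      ultimately show ?thesis using h_eq by (simp add: F_def)
    next
      case False
      then show ?thesis using glue_order[OF glue, of 1 3] h_eq by (auto simp: F_def)
    qed
  qed
  have h_le: "h x \<le> h y + dist x y" for x y
  proof -
    have "h y \<in> range (\<lambda>j. infdist (y $ j / sqrt 2) \<int>)" unfolding h_def by (intro Min_in) auto
    then obtain j where j: "h y = infdist (y $ j / sqrt 2) \<int>" by auto
    have "h x \<le> infdist (x $ j / sqrt 2) \<int>" unfolding h_def by (intro Min_le) auto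
    also have "\<dots> \<le> h y + \<bar>x $ j / sqrt 2 - y $ j / sqrt 2\<bar>"
      using infdist_Ints_diff_le[of "x $ j / sqrt 2" "y $ j / sqrt 2"] j by linarith
    also have "\<bar>x $ j / sqrt 2 - y $ j / sqrt 2\<bar> = dist (x $ j) (y $ j) / sqrt 2"
      by (simp add: dist_real_def diff_divide_distrib[symmetric])
    also have "\<dots> \<le> dist (x $ j) (y $ j) / 1"
      by (intro divide_left_mono) auto
    also have "dist (x $ j) (y $ j) / 1 \<le> dist x y" by (simp add: dist_vec_nth_le)
    finally show ?thesis by simp
  qed
  have lip: "\<bar>F (x, w) - F (y, w)\<bar> \<le> dist x y" for x y w
    using h_le[of x y] h_le[of y x] by (auto simp: F_def dist_commute)
  have "0 < h x" unfolding h_def using x by (subst Min_gr_iff) auto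
  then have "0 < \<bar>F (x, w) - F (y, w')\<bar>" using assms(1,2) by (simp add: F_def)
  also have "\<dots> \<le> Omega_dist (Omega_class (x, w)) (Omega_class (y, w'))"
    by (rule Omega_dist_lower_bound[OF _ lip string]) (auto dest: inv)
  finally show ?thesis .
qed

section \<open>The bigon at the vertex \<open>base_point\<close>\<close>

theorem theorem4p18:
  shows "\<not> locally_CAT0 (Omega :: 3 cell_point set set) Omega_dist"
proof
  assume loc: "locally_CAT0 (Omega :: 3 cell_point set set) Omega_dist"
  let ?o = "base_point :: real^3"
  define w1 w2 :: "nat \<Rightarrow> nat" where "w1 = Transposition.transpose 2 3"
    and "w2 = Transposition.transpose 1 2 \<circ> Transposition.transpose 2 3"
  have perm: "w1 permutes {1..3}" "w2 permutes {1..3}"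
    unfolding w1_def w2_def by (intro permutes_compose permutes_swap_id; simp)+
  have w_val: "w1 1 = 1" "w1 2 = 3" "w1 3 = 2" "w2 1 = 2" "w2 2 = 3" "w2 3 = 1"
    by (simp_all add: w1_def w2_def)
  define M where "M r = {y \<in> Omega. Omega_dist (Omega_class (?o, w1)) y < r}" for r
  have o_act: "?o = perm_act id ?o" by (subst perm_act_base_point_3) (simp add: base_point_3)
  have o_mem: "?o \<in> permutohedron"
    by (subst o_act) (auto simp: permutohedron_def sym_group_carrier permutes_id intro!: hull_inc)
  have cell: "(x, w) \<in> cell_points" if "x \<in> permutohedron" "w \<in> {w1, w2}" for x :: "real^3" and w
    using that perm by (auto simp: cell_points_def sym_group_carrier)
  obtain r where r: "0 < r" "CAT0_space (M r) Omega_dist"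
    using loc Omega_class_in_Omega[OF cell[OF o_mem]] unfolding locally_CAT0_def M_def by blast
  \<comment> \<open>The bound \<open>1 / 4\<close> keeps the segment where the triangular wave is
    linear; \<open>r / 3\<close> gives \<open>2 * e < r\<close>, which keeps it inside the
    ball.\<close>
  define e where "e = min (1 / 4) (r / 3)"
  have e: "0 < e" "e \<le> 1 / 4" "2 * e < r" using r by (auto simp: e_def min_def)
  define a b where "a = (1 - e) *\<^sub>R perm_act id ?o + e *\<^sub>R perm_act (coxeter_gen 1) ?o"
    and "b = (1 - e) *\<^sub>R perm_act id ?o + e *\<^sub>R perm_act (coxeter_gen 2) ?o"
  have a_face: "a \<in> perm_face id {coxeter_gen 1}" and b_face: "b \<in> perm_face id {coxeter_gen 2}"
    unfolding a_def b_def using e by (intro edge_mem_perm_face; simp)+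
  have a_eq: "Omega_class (a, w1) = Omega_class (a, w2)"
    by (rule Omega_class_eq_on_face[OF _ _ _ a_face])
      (use perm in \<open>auto simp: coxeter_gens_3 ordered_partition_edges[simplified] w_val[simplified]\<close>)
  have b_eq: "Omega_class (b, w1) = Omega_class (b, w2)"
    by (rule Omega_class_eq_on_face[OF _ _ _ b_face])
      (use perm in \<open>auto simp: coxeter_gens_3 ordered_partition_edges[simplified] w_val[simplified]\<close>)
  have "coxeter_gen i \<in> carrier (sym_group 3)" if "i \<in> {1, 2}" for i
    using coxeter_gens_permutes[of "coxeter_gens 3" 3] that by (auto simp: coxeter_gens_3)
  then have "perm_act id ?o \<in> permutohedron" "perm_act (coxeter_gen 1) ?o \<in> permutohedron"
    "perm_act (coxeter_gen 2) ?o \<in> permutohedron"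
    using o_mem o_act by (auto simp: permutohedron_def intro!: hull_inc)
  then have ab_mem: "a \<in> permutohedron" "b \<in> permutohedron"
    unfolding a_def b_def using e by (auto intro!: convexD_alt convex_permutohedron)
  define P where "P u = (1 - u) *\<^sub>R a + u *\<^sub>R b" for u
  have P_mem: "P u \<in> permutohedron" if "0 \<le> u" "u \<le> 1" for u
    unfolding P_def using that by (intro convexD_alt convex_permutohedron ab_mem)
  have gen_val: "coxeter_gen 1 1 = 2" "coxeter_gen 1 3 = 3" "coxeter_gen 2 1 = 1" "coxeter_gen 2 3 = 2"
    by (simp_all add: coxeter_gen_def)
  have P_coord: "P u $ 1 = sqrt 2 * (1 - e + u * e)" "P u $ 2 = sqrt 2 * (e - 2 * u * e)"
    "P u $ 3 = sqrt 2 * (- 1 + u * e)" for u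
    by (simp_all add: P_def a_def b_def perm_act_base_point_3 gen_val[simplified] axis_def algebra_simps)
  \<comment> \<open>This is the length of the segment, since \<open>b - a\<close> is
    \<open>sqrt 2 * e\<close> times (1, -2, 1).\<close>
  define l where "l = 2 * sqrt 3 * e"
  have l: "0 < l" using e by (simp add: l_def)
  have P_dist: "dist (P u) (P v) = l * \<bar>u - v\<bar>" for u v
  proof -
    have "dist (P u) (P v) = sqrt (12 * e\<^sup>2 * (u - v)\<^sup>2)"
      unfolding dist_norm norm_real_3
      by (rule arg_cong[where f = sqrt])
        (simp add: P_coord right_diff_distrib[symmetric] power_mult_distrib,
         simp add: power2_eq_square algebra_simps)
    also have "12 * e\<^sup>2 * (u - v)\<^sup>2 = (l * \<bar>u - v\<bar>)\<^sup>2"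
      by (simp add: l_def power_mult_distrib)
    finally show ?thesis using l by simp
  qed
  have o_dist: "dist ?o (P u) < r" if "0 \<le> u" "u \<le> 1" for u
  proof -
    have o_coord: "?o $ 1 = sqrt 2 * 1" "?o $ 2 = sqrt 2 * 0" "?o $ 3 = sqrt 2 * (- 1)"
      by (simp_all add: base_point_3 axis_def)
    have "dist ?o (P u) = sqrt (2 * e\<^sup>2 * (2 - 6 * (u * (1 - u))))"
      unfolding dist_norm norm_real_3
      by (rule arg_cong[where f = sqrt], unfold vector_minus_component P_coord o_coord
          right_diff_distrib[symmetric] power_mult_distrib)
        (simp add: power2_eq_square algebra_simps)
    also have "\<dots> \<le> sqrt ((2 * e)\<^sup>2)"
      using that e by (intro real_sqrt_le_mono) (simp add: power_mult_distrib mult_left_le)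
    also have "\<dots> = 2 * e" using e by (intro real_sqrt_unique) auto
    finally show ?thesis using e by linarith
  qed
  have d_eq: "Omega_dist (Omega_class (P u, w)) (Omega_class (P v, w)) = l * \<bar>u - v\<bar>"
    if "0 \<le> u" "u \<le> 1" "0 \<le> v" "v \<le> 1" "w \<in> {w1, w2}" for u v w
  proof -
    \<comment> \<open>The scaled second coordinate decreases linearly from \<open>e\<close> to
      \<open>- e\<close> along the segment.\<close>
    have coord2: "\<bar>P u $ 2 / sqrt 2\<bar> \<le> 1 / 4" if "0 \<le> u" "u \<le> 1" for u
    proof -
      have "\<bar>e - 2 * u * e\<bar> = e * \<bar>1 - 2 * u\<bar>" using e by (simp add: abs_mult_pos' algebra_simps)
      also have "\<dots> \<le> (1 / 4) * 1" using e that by (intro mult_mono) auto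
      finally show ?thesis by (simp add: P_coord)
    qed
    have z2: "P u $ 2 / sqrt 2 = e - 2 * u * e" for u by (simp add: P_coord)
    have "\<bar>P u $ 2 / sqrt 2 - P v $ 2 / sqrt 2\<bar> = \<bar>2 * e * (v - u)\<bar>"
      unfolding z2 by (simp add: algebra_simps)
    then have "dist (P u) (P v) = sqrt 3 * \<bar>P u $ 2 / sqrt 2 - P v $ 2 / sqrt 2\<bar>"
      using e by (simp add: P_dist l_def abs_mult abs_minus_commute)
    then show ?thesis
      using Omega_dist_3_cell_eq[OF P_mem P_mem, of u v w] that perm coord2 P_dist by auto
  qed
  have in_M: "Omega_class (P u, w) \<in> M r" if "0 \<le> u" "u \<le> 1" "w \<in> {w1, w2}" for u w
  proof -
    \<comment> \<open>The ball is centred at the vertex seen in the hexagon of \<open>w1\<close>.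
      Being an end of a shared edge, this vertex is the same point of the complex in the hexagon of
      \<open>w2\<close>.\<close>
    have "?o \<in> perm_face id {coxeter_gen 1}"
      by (subst o_act) (use edge_mem_perm_face[of "coxeter_gen 1" "{coxeter_gen 1}" 0] in simp)
    then have "Omega_class (?o, w1) = Omega_class (?o, w2)"
      by (rule Omega_class_eq_on_face[rotated 3])
        (use perm in \<open>auto simp: coxeter_gens_3 ordered_partition_edges[simplified] w_val[simplified]\<close>)
    then have "Omega_class (?o, w1) = Omega_class (?o, w)" using that by auto
    then have "Omega_dist (Omega_class (?o, w1)) (Omega_class (P u, w)) \<le> dist ?o (P u)"
      using Omega_dist_cell_le[OF cell[OF o_mem] cell[OF P_mem]] that by simp
    then show ?thesis
      using o_dist[OF that(1,2)] Omega_class_in_Omega[OF cell[OF P_mem]] that by (auto simp: M_def)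
  qed
  have unit: "0 \<le> t / l" "t / l \<le> 1" "0 \<le> 1 - t / l" "1 - t / l \<le> 1" if "t \<in> {0..l}" for t
    using that l by (auto simp: divide_simps)
  have scale: "l * \<bar>s / l - t / l\<bar> = \<bar>s - t\<bar>" for s t
    using l by (simp add: diff_divide_distrib[symmetric] abs_divide)
  \<comment> \<open>\<open>c2\<close> runs backwards, as the second side of a triangle has to start
    where the first one ends.\<close>
  define c1 c2 where "c1 t = Omega_class (P (t / l), w1)" and "c2 t = Omega_class (P (1 - t / l), w2)" for t
  have P01: "P 0 = a" "P 1 = b" by (simp_all add: P_def)
  have g1: "geodesic_path (M r) Omega_dist c1 l (Omega_class (a, w1)) (Omega_class (b, w1))"
    using l in_M unit scale d_eq by (auto simp: geodesic_path_def c1_def P01)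
  have "l * \<bar>(1 - s / l) - (1 - t / l)\<bar> = \<bar>s - t\<bar>" for s t
    using scale[of t s] by (simp add: abs_minus_commute)
  then have g2: "geodesic_path (M r) Omega_dist c2 l (Omega_class (b, w1)) (Omega_class (a, w1))"
    using l in_M unit d_eq by (auto simp: geodesic_path_def c2_def P01 a_eq b_eq)
  \<comment> \<open>The midpoint would not do: its second coordinate is 0, so the separating
    function vanishes there.\<close>
  have "Omega_dist (c1 (l / 4)) (c2 (l - l / 4)) \<le> 0"
    by (rule CAT0_space_unique_geodesic[OF r(2) g1 g2]) (use l in auto)
  then have "Omega_dist (Omega_class (P (1 / 4), w1)) (Omega_class (P (1 / 4), w2)) \<le> 0"
    using l by (simp add: c1_def c2_def diff_divide_distrib)
  moreover have "0 < Omega_dist (Omega_class (P (1 / 4), w1)) (Omega_class (P (1 / 4), w2))"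
  proof (rule Omega_dist_3_pos)
    show "w1 1 < w1 3" "\<not> w2 1 < w2 3" by (simp_all add: w_val[simplified])
    \<comment> \<open>The scaled coordinates are \<open>1 - 3 / 4 * e\<close>, \<open>e / 2\<close>
      and \<open>- 1 + e / 4\<close>, none of them integral.\<close>
    have "0 < infdist (P (1 / 4) $ j / sqrt 2) \<int>" if "j \<in> {1, 2, 3}" for j
      using that e infdist_Ints_pos[of 0 "1 - e + 1 / 4 * e"] infdist_Ints_pos[of 0 "e - 2 * (1 / 4) * e"]
        infdist_Ints_pos[of "-1" "- 1 + 1 / 4 * e"]
      by (auto simp: P_coord)
    then show "0 < infdist (P (1 / 4) $ j / sqrt 2) \<int>" for j using UNIV_3 by auto
    have P4: "(P (1 / 4), w) \<in> cell_points" if "w \<in> {w1, w2}" for w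
      using that by (intro cell P_mem) auto
    \<comment> \<open>A path between the two hexagons passes through \<open>a\<close>, which lies on
      a shared edge.\<close>
    have "Omega_string (Omega_class (P (1 / 4), w1)) (Omega_class (a, w2)) (dist (P (1 / 4)) a)"
      unfolding a_eq[symmetric] using P4 cell[OF ab_mem(1)] by (intro Omega_string_cell) auto
    then show "Omega_string (Omega_class (P (1 / 4), w1)) (Omega_class (P (1 / 4), w2))
        (dist (P (1 / 4)) a + dist a (P (1 / 4)))"
      using P4 cell[OF ab_mem(1)] by (intro Omega_string.step) auto
  qed
  ultimately show False by simp
qed

end
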